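(* Let $p\ge 1$ be a real number, let $(F,\|\cdot\|_F)$ be a separable complex Banach space, and let $X,Y\in L_p(F)$ be two independent $F$-valued $p$-integrable random vectors. Then $$\inf_{z\in F}\mathbb{E}\left[\|X-z\|_F^p+\|Y-z\|_F^p\right]\le \frac{3^p}{2^{p-1}}\,\mathbb{E}\left[\|X-Y\|_F^p\right].$$ The constant $\frac{3^p}{2^{p-1}}$ cannot be improved: for every $p\ge 1$ and every real $C<\frac{3^p}{2^{p-1}}$ there exist a separable complex Banach space $F$ and independent $X,Y\in L_p(F)$ for which the inequality with $C$ in place of $\frac{3^p}{2^{p-1}}$ fails.
   Context: $L_p(F)$ denotes the space of $F$-valued random vectors $X$ with $\mathbb{E}[\|X\|_F^p]<\infty$. *)

theory Defs
  imports "HOL-Probability.Probability" "HOL-Library.Function_Algebras"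
begin

text \<open>
  The library has no complex normed spaces, and HOL cannot assert the existence of a type.
  A complex normed space is therefore a carrier: a linear subspace \<open>F\<close> of an ambient complex
  vector space (possibly all of it), with a norm that is constrained on \<open>F\<close> only.
  The ambient space carries no topology. Every separable complex Banach space has Hamel dimension
  at most the continuum and so occurs, up to isometry, with a carrier in \<open>nat \<Rightarrow> complex\<close>.
\<close>

locale complex_normed_space = vector_space scale
  for scale :: "complex \<Rightarrow> 'v::ab_group_add \<Rightarrow> 'v" +
  fixes F :: "'v set" and nrm :: "'v \<Rightarrow> real"
  assumes subspace_F: "module.subspace scale F"
    and nrm_nonneg: "x \<in> F \<Longrightarrow> 0 \<le> nrm x"
    and nrm_eq_0_iff: "x \<in> F \<Longrightarrow> nrm x = 0 \<longleftrightarrow> x = 0"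
    and nrm_triangle: "x \<in> F \<Longrightarrow> y \<in> F \<Longrightarrow> nrm (x + y) \<le> nrm x + nrm y"
    and nrm_scale: "x \<in> F \<Longrightarrow> nrm (scale c x) = cmod c * nrm x"

text \<open>
  The value off \<open>F\<close> is immaterial; it is fixed because the locale \<^locale>\<open>Metric_space\<close> asks for
  nonnegativity and symmetry on the whole type.
\<close>

definition norm_dist :: "'v::ab_group_add set \<Rightarrow> ('v \<Rightarrow> real) \<Rightarrow> 'v \<Rightarrow> 'v \<Rightarrow> real" where
  "norm_dist F nrm x y = (if x \<in> F \<and> y \<in> F then nrm (x - y) else 0)"

definition norm_topology :: "'v::ab_group_add set \<Rightarrow> ('v \<Rightarrow> real) \<Rightarrow> 'v topology" where
  "norm_topology F nrm = Metric_space.mtopology F (norm_dist F nrm)"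

definition norm_borel :: "'v::ab_group_add set \<Rightarrow> ('v \<Rightarrow> real) \<Rightarrow> 'v measure" where
  "norm_borel F nrm = sigma F {U. openin (norm_topology F nrm) U}"

context complex_normed_space
begin

lemma diff_mem_F: "x \<in> F \<Longrightarrow> y \<in> F \<Longrightarrow> x - y \<in> F"
  using subspace_F by (rule subspace_diff)

lemma nrm_minus_commute:
  assumes "x \<in> F" "y \<in> F"
  shows "nrm (x - y) = nrm (y - x)"
  using nrm_scale[OF diff_mem_F[OF assms], of "-1"] by simp

sublocale Metric_space F "norm_dist F nrm"
proof
  fix x y z assume "x \<in> F" "y \<in> F" "z \<in> F"
  then show "norm_dist F nrm x z \<le> norm_dist F nrm x y + norm_dist F nrm y z"
    using nrm_triangle[of "x - y" "y - z"] by (simp add: norm_dist_def diff_mem_F)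
qed (auto simp: norm_dist_def diff_mem_F nrm_nonneg nrm_eq_0_iff nrm_minus_commute)

end

locale separable_complex_banach_space = complex_normed_space +
  assumes complete: "Metric_space.mcomplete F (norm_dist F nrm)"
    and separable: "separable_space (norm_topology F nrm)"

text \<open>
  Random vectors are Borel measurable functions into \<open>F\<close>, not equivalence classes modulo null sets.
\<close>

definition Lp_vec :: "real \<Rightarrow> 'a measure \<Rightarrow> 'v::ab_group_add set \<Rightarrow> ('v \<Rightarrow> real) \<Rightarrow> ('a \<Rightarrow> 'v) set" where
  "Lp_vec p M F nrm =
     {X \<in> M \<rightarrow>\<^sub>M norm_borel F nrm. integrable M (\<lambda>\<omega>. nrm (X \<omega>) powr p)}"

lemma norm_borel_UNIV: "norm_borel UNIV norm = (borel :: 'v::real_normed_vector measure)"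
proof -
  have "norm_dist UNIV norm = (dist :: 'v \<Rightarrow> 'v \<Rightarrow> real)"
    by (simp add: norm_dist_def dist_norm fun_eq_iff)
  then show ?thesis
    by (simp add: norm_borel_def norm_topology_def borel_def)
qed

end

theory Submission
  imports Defs
begin

text \<open>
  Upper bound. Fix points \<open>a\<close> and \<open>b\<close> and use their midpoint \<open>z\<close> as the centre. The triangle
  inequality gives \<open>\<parallel>X - z\<parallel> \<le> \<parallel>X - b\<parallel> + \<parallel>a - b\<parallel> / 2\<close> and \<open>\<parallel>Y - z\<parallel> \<le> \<parallel>Y - a\<parallel> + \<parallel>a - b\<parallel> / 2\<close>. Each
  right-hand side is \<open>3 / 2\<close> times an average of three distances, so convexity of the \<open>p\<close>-th power
  bounds its \<open>p\<close>-th power by \<open>(3 / 2) powr p\<close> times the average of their \<open>p\<close>-th powers. If \<open>a\<close> is an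
  independent copy of \<open>X\<close> and \<open>b\<close> one of \<open>Y\<close>, all these distances are distributed as \<open>\<parallel>X - Y\<parallel>\<close>, and
  the two bounds together are \<open>2 * (3 / 2) powr p\<close> times the expectation of \<open>\<parallel>X - Y\<parallel> powr p\<close>. The
  infimum over \<open>z\<close> is at most this average over random \<open>z\<close>. This is \<open>INF_expectation_le\<close>; it needs
  Fubini's theorem (\<open>indep_var_Fubini\<close>), and the joint measurability of the distance
  (\<open>borel_measurable_nrm_diff\<close>), which is where separability enters.

  Sharpness. All the inequalities above must be nearly tight: points of one kind should be at
  distance 1 from those of the other kind, at distance 2 from each other, and no centre should be
  closer than about \<open>3 / 2\<close> on average. In the space of vectors in \<open>2 * n\<close> coordinates with sum zero,
  under the sup norm, this happens for \<open>2 * n\<close> vectors, one for each coordinate, whose entries are up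
  to a correction of \<open>1 / n\<close> equal to \<open>3 / 2\<close> at that coordinate, \<open>- 1 / 2\<close> at the other coordinates
  of the same half and \<open>1 / 2\<close> on the other half. With \<open>X\<close> and \<open>Y\<close> uniform on the vectors of the two
  halves, \<open>\<parallel>X - Y\<parallel> = 1\<close> always. For a centre \<open>z\<close>, evaluation of each difference at the peak gives
  \<open>3 / 2 - 1 / n - z m\<close>, and the coordinates \<open>z m\<close> sum to zero, so by convexity the left-hand side is
  at least \<open>2 * (3 / 2 - 1 / n) powr p\<close> (\<open>sum_powr_max_norm_spike_ge\<close>, \<open>exists_spike_vectors\<close>). For
  \<open>n \<rightarrow> \<infinity>\<close> this tends to the constant.
\<close>

section \<open>Convexity of the power function\<close>

text \<open>
  The tangent line of a convex function lies below its graph. The point \<open>t = 0\<close> is treated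
  separately because it lies on the boundary of the half line on which \<open>t powr p\<close> is differentiable. The two
  uses of Jensen's inequality below average this bound over several values of \<open>t\<close>. If \<open>c\<close> is their
  mean, the linear terms cancel; if \<open>c\<close> is only a lower bound of the mean, they add up to a
  nonnegative number.
\<close>

lemma powr_ge_tangent:
  fixes p t c :: real
  assumes "p \<ge> 1" "t \<ge> 0" "c > 0"
  shows "c powr p + p * c powr (p - 1) * (t - c) \<le> t powr p"
proof (cases "t = 0")
  case True
  have "c powr (p - 1) * c = c powr p"
    using assms by (simp add: powr_diff)
  then show ?thesis
    using True assms mult_right_mono[of 1 p "c powr p"] by (simp add: algebra_simps)
next
  case False
  have "p * c powr (p - 1) * (t - c) \<le> t powr p - c powr p"
  proof (rule convex_on_imp_above_tangent[OF powr_convex[OF assms(1)]])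
    show "((\<lambda>x. x powr p) has_real_derivative p * c powr (p - 1)) (at c within {0<..})"
      using assms by (auto intro!: derivative_eq_intros)
  qed (use False assms in \<open>auto simp: interior_open connected_iff_interval\<close>)
  then show ?thesis by simp
qed

text \<open>
  Since \<open>s + t / 2\<close> is \<open>3 / 2\<close> times the average of \<open>s\<close>, \<open>s\<close> and \<open>t\<close>, this is Jensen's inequality
  with weights \<open>2 / 3\<close> and \<open>1 / 3\<close>. There is equality for \<open>s = t\<close>, so the
  constant cannot be lowered here.
\<close>

lemma powr_add_half_le:
  fixes p s t :: real
  assumes "p \<ge> 1" "s \<ge> 0" "t \<ge> 0"
  shows "(s + t / 2) powr p \<le> (3 / 2) powr p * (2 / 3 * s powr p + 1 / 3 * t powr p)"
proof (cases "s = 0 \<and> t = 0")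
  case True
  then show ?thesis by simp
next
  case False
  define m where "m = (2 * s + t) / 3"
  have m: "m > 0"
    using False assms unfolding m_def by auto
  define l where "l = p * m powr (p - 1)"
  have "m powr p + l * (s - m) \<le> s powr p" "m powr p + l * (t - m) \<le> t powr p"
    unfolding l_def using powr_ge_tangent assms m by auto
  moreover have "2 / 3 * (l * (s - m)) + 1 / 3 * (l * (t - m)) = 0"
    unfolding m_def by (simp add: field_simps)
  ultimately have "m powr p \<le> 2 / 3 * s powr p + 1 / 3 * t powr p"
    by argo
  then have "(3 / 2) powr p * m powr p \<le> (3 / 2) powr p * (2 / 3 * s powr p + 1 / 3 * t powr p)"
    by (rule mult_left_mono) simp
  moreover have "(3 / 2 * m) powr p = (3 / 2) powr p * m powr p"
    by (rule powr_mult)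
  moreover have "3 / 2 * m = s + t / 2"
    by (simp add: m_def)
  ultimately show ?thesis
    by metis
qed

section \<open>Fubini's theorem for independent random variables\<close>

text \<open>
  Independence says that the joint law is the product of the two marginal laws, so averaging over a
  fresh copy of one variable while keeping the other is an iterated integral for that product.
\<close>

lemma (in prob_space) indep_var_Fubini:
  fixes f :: "'b \<times> 'b \<Rightarrow> real"
  assumes indep: "indep_var S X T Y"
    and f [measurable]: "f \<in> borel_measurable (S \<Otimes>\<^sub>M T)"
    and int: "integrable M (\<lambda>\<omega>. f (X \<omega>, Y \<omega>))"
  shows "integrable M (\<lambda>\<omega>. expectation (\<lambda>\<omega>'. f (X \<omega>, Y \<omega>')))"
    and "expectation (\<lambda>\<omega>. expectation (\<lambda>\<omega>'. f (X \<omega>, Y \<omega>'))) = expectation (\<lambda>\<omega>. f (X \<omega>, Y \<omega>))"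
    and "integrable M (\<lambda>\<omega>. expectation (\<lambda>\<omega>'. f (X \<omega>', Y \<omega>)))"
    and "expectation (\<lambda>\<omega>. expectation (\<lambda>\<omega>'. f (X \<omega>', Y \<omega>))) = expectation (\<lambda>\<omega>. f (X \<omega>, Y \<omega>))"
proof -
  have X [measurable]: "X \<in> M \<rightarrow>\<^sub>M S" and Y [measurable]: "Y \<in> M \<rightarrow>\<^sub>M T"
    and joint: "distr M S X \<Otimes>\<^sub>M distr M T Y = distr M (S \<Otimes>\<^sub>M T) (\<lambda>\<omega>. (X \<omega>, Y \<omega>))"
    using indep unfolding indep_var_distribution_eq by auto
  interpret PX: prob_space "distr M S X" by (rule prob_space_distr) fact
  interpret PY: prob_space "distr M T Y" by (rule prob_space_distr) fact
  interpret P: pair_prob_space "distr M S X" "distr M T Y" ..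
  have fI: "integrable (distr M S X \<Otimes>\<^sub>M distr M T Y) (\<lambda>(x, y). f (x, y))"
    unfolding joint using int by (simp add: integrable_distr_eq)
  have fE: "integral\<^sup>L (distr M S X \<Otimes>\<^sub>M distr M T Y) (\<lambda>(x, y). f (x, y)) = expectation (\<lambda>\<omega>. f (X \<omega>, Y \<omega>))"
    unfolding joint by (simp add: integral_distr)
  have inner1: "(\<integral>y. f (x, y) \<partial>distr M T Y) = expectation (\<lambda>\<omega>. f (x, Y \<omega>))" if "x \<in> space S" for x
    using that by (simp add: integral_distr)
  have inner2: "(\<integral>x. f (x, y) \<partial>distr M S X) = expectation (\<lambda>\<omega>. f (X \<omega>, y))" if "y \<in> space T" for y
    using that by (simp add: integral_distr)
  have XS: "X \<omega> \<in> space S" and YT: "Y \<omega> \<in> space T" if "\<omega> \<in> space M" for \<omega>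
    using measurable_space[OF X that] measurable_space[OF Y that] .
  have m1 [measurable]: "(\<lambda>x. \<integral>y. f (x, y) \<partial>distr M T Y) \<in> borel_measurable S"
    using PY.borel_measurable_lebesgue_integral[of "\<lambda>x y. f (x, y)" S] by simp
  have m2 [measurable]: "(\<lambda>y. \<integral>x. f (x, y) \<partial>distr M S X) \<in> borel_measurable T"
  proof -
    have "(\<lambda>(y, x). f (x, y)) \<in> borel_measurable (T \<Otimes>\<^sub>M distr M S X)" by simp
    then show ?thesis
      using PX.borel_measurable_lebesgue_integral[of "\<lambda>y x. f (x, y)" T] by simp
  qed
  have 1: "integrable M (\<lambda>\<omega>. \<integral>y. f (X \<omega>, y) \<partial>distr M T Y)"
    using P.integrable_fst[OF fI] by (subst (asm) integrable_distr_eq) auto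
  then show "integrable M (\<lambda>\<omega>. expectation (\<lambda>\<omega>'. f (X \<omega>, Y \<omega>')))"
    by (rule iffD1[OF Bochner_Integration.integrable_cong[OF refl], rotated]) (simp add: inner1 XS)
  have 2: "integrable M (\<lambda>\<omega>. \<integral>x. f (x, Y \<omega>) \<partial>distr M S X)"
    using P.integrable_snd[OF fI] by (subst (asm) integrable_distr_eq) auto
  then show "integrable M (\<lambda>\<omega>. expectation (\<lambda>\<omega>'. f (X \<omega>', Y \<omega>)))"
    by (rule iffD1[OF Bochner_Integration.integrable_cong[OF refl], rotated]) (simp add: inner2 YT)
  have "expectation (\<lambda>\<omega>. expectation (\<lambda>\<omega>'. f (X \<omega>, Y \<omega>'))) = expectation (\<lambda>\<omega>. \<integral>y. f (X \<omega>, y) \<partial>distr M T Y)"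
    by (rule Bochner_Integration.integral_cong) (simp_all add: inner1 XS)
  also have "\<dots> = (\<integral>x. \<integral>y. f (x, y) \<partial>distr M T Y \<partial>distr M S X)"
    by (simp add: integral_distr)
  also have "\<dots> = expectation (\<lambda>\<omega>. f (X \<omega>, Y \<omega>))"
    using P.integral_fst[OF fI] fE by simp
  finally show "expectation (\<lambda>\<omega>. expectation (\<lambda>\<omega>'. f (X \<omega>, Y \<omega>'))) = expectation (\<lambda>\<omega>. f (X \<omega>, Y \<omega>))" .
  have "expectation (\<lambda>\<omega>. expectation (\<lambda>\<omega>'. f (X \<omega>', Y \<omega>))) = expectation (\<lambda>\<omega>. \<integral>x. f (x, Y \<omega>) \<partial>distr M S X)"
    by (rule Bochner_Integration.integral_cong) (simp_all add: inner2 YT)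
  also have "\<dots> = (\<integral>y. \<integral>x. f (x, y) \<partial>distr M S X \<partial>distr M T Y)"
    by (simp add: integral_distr)
  also have "\<dots> = expectation (\<lambda>\<omega>. f (X \<omega>, Y \<omega>))"
    using P.integral_snd[OF fI] fE by simp
  finally show "expectation (\<lambda>\<omega>. expectation (\<lambda>\<omega>'. f (X \<omega>', Y \<omega>))) = expectation (\<lambda>\<omega>. f (X \<omega>, Y \<omega>))" .
qed

section \<open>The upper bound in an arbitrary separable space\<close>

context complex_normed_space
begin

lemma nrm_diff_triangle:
  assumes "x \<in> F" "y \<in> F" "z \<in> F"
  shows "nrm (x - z) \<le> nrm (x - y) + nrm (y - z)"
  using nrm_triangle[of "x - y" "y - z"] assms by (simp add: diff_mem_F)

lemma space_norm_borel: "space (norm_borel F nrm) = F"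
  by (simp add: norm_borel_def space_measure_of_conv)

lemma ball_in_sets_norm_borel:
  assumes "a \<in> F"
  shows "{x \<in> F. nrm (x - a) < r} \<in> sets (norm_borel F nrm)"
proof -
  have "{x \<in> F. nrm (x - a) < r} = mball a r"
    using assms by (auto simp: norm_dist_def nrm_minus_commute)
  moreover have "{U. openin (norm_topology F nrm) U} \<subseteq> Pow F"
    unfolding norm_topology_def using openin_subset topspace_mtopology by blast
  ultimately show ?thesis
    by (simp add: norm_borel_def sets_measure_of sigma_sets.Basic norm_topology_def)
qed

text \<open>
  The path from \<open>x\<close> to the midpoint \<open>(a + b) / 2\<close> through \<open>b\<close> has as its second leg one half of the
  segment from \<open>b\<close> to \<open>a\<close>. Exchanging \<open>a\<close> and \<open>b\<close> gives the path through \<open>a\<close>.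
\<close>

lemma nrm_diff_midpoint_le:
  assumes "x \<in> F" "a \<in> F" "b \<in> F"
  shows "scale (1/2) (a + b) \<in> F"
    and "nrm (x - scale (1/2) (a + b)) \<le> nrm (x - b) + nrm (a - b) / 2"
proof -
  define z where "z = scale (1/2) (a + b)"
  show zF: "scale (1/2) (a + b) \<in> F"
    using assms subspace_F by (auto intro: subspace_scale subspace_add)
  have "scale (1/2) b + scale (1/2) b = b"
    using scale_left_distrib[of "1/2" "1/2" b] by simp
  then have "b - z = scale (1/2) (b - a)"
    unfolding z_def by (simp add: scale_right_distrib scale_right_diff_distrib algebra_simps)
  then have "nrm (b - z) = nrm (a - b) / 2"
    using assms by (simp add: nrm_scale diff_mem_F nrm_minus_commute)
  then show "nrm (x - scale (1/2) (a + b)) \<le> nrm (x - b) + nrm (a - b) / 2"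
    using nrm_diff_triangle[of x b z] assms zF by (simp add: z_def)
qed

end

context separable_complex_banach_space
begin

text \<open>
  The Borel \<open>\<sigma>\<close>-algebra of a product can be larger than the product of the Borel \<open>\<sigma>\<close>-algebras, and
  continuity of the norm gives measurability for the larger one only. Separability helps: two points are at distance
  less than \<open>r\<close> exactly if some point of a countable dense set is closer than some rational \<open>q\<close> to
  the first and closer than \<open>r - q\<close> to the second.
\<close>

lemma borel_measurable_nrm_diff:
  "(\<lambda>(x, y). nrm (x - y)) \<in> borel_measurable (norm_borel F nrm \<Otimes>\<^sub>M norm_borel F nrm)"
proof (rule borel_measurableI_less)
  fix r :: real
  let ?B = "norm_borel F nrm"
  obtain D where D: "countable D" "D \<subseteq> F" and "mtopology closure_of D = F"
    using separable unfolding separable_space_def norm_topology_def by auto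
  then have dense: "\<exists>a\<in>D. nrm (x - a) < e" if "x \<in> F" "e > 0" for x e
    using that unfolding metric_closure_of by (force simp: norm_dist_def)
  let ?U = "\<Union>a\<in>D. \<Union>q\<in>\<rat>. {x \<in> F. nrm (x - a) < q} \<times> {y \<in> F. nrm (y - a) < r - q}"
  have "{w \<in> space (?B \<Otimes>\<^sub>M ?B). (case w of (x, y) \<Rightarrow> nrm (x - y)) < r} = ?U"
  proof (intro equalityI subsetI)
    fix w assume "w \<in> {w \<in> space (?B \<Otimes>\<^sub>M ?B). (case w of (x, y) \<Rightarrow> nrm (x - y)) < r}"
    then obtain x y where w: "w = (x, y)" "x \<in> F" "y \<in> F" and r: "nrm (x - y) < r"
      by (auto simp: space_pair_measure space_norm_borel)
    \<comment> \<open>With a dense point within \<open>e\<close> of \<open>x\<close>, a radius \<open>q\<close> works if it exceeds \<open>e\<close> and if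
      \<open>nrm (x - y) + e < r - q\<close>, that is, \<open>q < 2 * e\<close>.\<close>
    define e where "e = (r - nrm (x - y)) / 3"
    have "e > 0" using r by (simp add: e_def)
    with dense w obtain a where a: "a \<in> D" "nrm (x - a) < e" by blast
    obtain q where q: "q \<in> \<rat>" "e < q" "q < 2 * e"
      using Rats_dense_in_real[of e "2 * e"] \<open>e > 0\<close> by auto
    have "nrm (y - a) \<le> nrm (x - y) + nrm (x - a)"
      using nrm_diff_triangle[of y x a] w a D by (auto simp: nrm_minus_commute)
    also have "\<dots> < r - q"
      using a q by (simp add: e_def)
    finally show "w \<in> ?U"
      using w a q
      by (intro UN_I[of a] UN_I[of q]) auto
  next
    fix w assume "w \<in> ?U"
    then obtain a q x y where *: "a \<in> D" "w = (x, y)" "x \<in> F" "y \<in> F"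
        "nrm (x - a) < q" "nrm (y - a) < r - q"
      by auto
    then have "nrm (x - y) < r"
      using nrm_diff_triangle[of x a y] nrm_minus_commute[of y a] D by force
    with * show "w \<in> {w \<in> space (?B \<Otimes>\<^sub>M ?B). (case w of (x, y) \<Rightarrow> nrm (x - y)) < r}"
      by (simp add: space_pair_measure space_norm_borel)
  qed
  also have "?U \<in> sets (?B \<Otimes>\<^sub>M ?B)"
  proof (rule sets.countable_UN''[OF D(1)], rule sets.countable_UN''[OF countable_rat])
    fix a q assume "a \<in> D"
    then show "{x \<in> F. nrm (x - a) < q} \<times> {y \<in> F. nrm (y - a) < r - q} \<in> sets (?B \<Otimes>\<^sub>M ?B)"
      using D by (intro pair_measureI ball_in_sets_norm_borel) auto
  qed
  finally show "{w \<in> space (?B \<Otimes>\<^sub>M ?B). (case w of (x, y) \<Rightarrow> nrm (x - y)) < r} \<in> sets (?B \<Otimes>\<^sub>M ?B)" .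
qed

lemma measurable_nrm_diff:
  assumes "X \<in> M \<rightarrow>\<^sub>M norm_borel F nrm" "Y \<in> M \<rightarrow>\<^sub>M norm_borel F nrm"
  shows "(\<lambda>\<omega>. nrm (X \<omega> - Y \<omega>)) \<in> borel_measurable M"
  using measurable_compose[OF measurable_Pair[OF assms] borel_measurable_nrm_diff] by simp

lemma Lp_vec_integrable_diff:
  assumes p: "p \<ge> 1" and "X \<in> Lp_vec p M F nrm" "Y \<in> Lp_vec p M F nrm"
  shows "integrable M (\<lambda>\<omega>. nrm (X \<omega> - Y \<omega>) powr p)"
proof (rule Bochner_Integration.integrable_bound)
  have X: "X \<in> M \<rightarrow>\<^sub>M norm_borel F nrm" and Y: "Y \<in> M \<rightarrow>\<^sub>M norm_borel F nrm"
    using assms by (auto simp: Lp_vec_def)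
  show "integrable M (\<lambda>\<omega>. 2 powr p * (nrm (X \<omega>) powr p + nrm (Y \<omega>) powr p))"
    using assms by (auto simp: Lp_vec_def)
  have [measurable]: "(\<lambda>\<omega>. nrm (X \<omega> - Y \<omega>)) \<in> borel_measurable M"
    using X Y by (rule measurable_nrm_diff)
  show "(\<lambda>\<omega>. nrm (X \<omega> - Y \<omega>) powr p) \<in> borel_measurable M"
    by measurable
  show "AE \<omega> in M. norm (nrm (X \<omega> - Y \<omega>) powr p)
          \<le> norm (2 powr p * (nrm (X \<omega>) powr p + nrm (Y \<omega>) powr p))"
  proof (rule AE_I2)
    fix \<omega> assume "\<omega> \<in> space M"
    then have F: "X \<omega> \<in> F" "Y \<omega> \<in> F" "0 \<in> F"
      using X Y subspace_F by (auto dest: measurable_space simp: space_norm_borel subspace_0)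
    let ?m = "max (nrm (X \<omega>)) (nrm (Y \<omega>))"
    have "nrm (X \<omega> - Y \<omega>) \<le> nrm (X \<omega>) + nrm (Y \<omega>)"
      using nrm_diff_triangle[of "X \<omega>" 0 "Y \<omega>"] nrm_minus_commute[of 0 "Y \<omega>"] F by simp
    also have "\<dots> \<le> 2 * ?m" by simp
    finally have "nrm (X \<omega> - Y \<omega>) powr p \<le> (2 * ?m) powr p"
      using p F by (intro powr_mono2) (auto simp: nrm_nonneg diff_mem_F)
    also have "\<dots> = 2 powr p * ?m powr p"
      by (rule powr_mult)
    also have "\<dots> \<le> 2 powr p * (nrm (X \<omega>) powr p + nrm (Y \<omega>) powr p)"
      by (intro mult_left_mono) (auto simp: max_def)
    finally show "norm (nrm (X \<omega> - Y \<omega>) powr p)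
          \<le> norm (2 powr p * (nrm (X \<omega>) powr p + nrm (Y \<omega>) powr p))"
      by simp
  qed
qed

text \<open>
  For fixed \<open>a\<close> and \<open>b\<close> the midpoint \<open>z = (a + b) / 2\<close> is a candidate centre. Routing \<open>X\<close> to \<open>z\<close>
  through \<open>b\<close> and \<open>Y\<close> to \<open>z\<close> through \<open>a\<close> bounds the cost of \<open>z\<close> by distances of an \<open>X\<close>-like point
  to a \<open>Y\<close>-like point only. Averaging over \<open>a\<close> distributed as \<open>X\<close> and \<open>b\<close> distributed as \<open>Y\<close> then
  turns each of the three terms into \<open>expectation (\<lambda>\<omega>. nrm (X \<omega> - Y \<omega>) powr p)\<close>.
\<close>

lemma INF_expectation_le:
  fixes M :: "'w measure"
  assumes p: "p \<ge> 1" and M: "prob_space M"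
    and X: "X \<in> Lp_vec p M F nrm" and Y: "Y \<in> Lp_vec p M F nrm"
    and indep: "prob_space.indep_var M (norm_borel F nrm) X (norm_borel F nrm) Y"
  shows "(INF z\<in>F. prob_space.expectation M (\<lambda>\<omega>. nrm (X \<omega> - z) powr p + nrm (Y \<omega> - z) powr p))
           \<le> 3 powr p / 2 powr (p - 1) * prob_space.expectation M (\<lambda>\<omega>. nrm (X \<omega> - Y \<omega>) powr p)"
    (is "?I \<le> _")
proof -
  interpret prob_space M by fact
  have XF: "X \<omega> \<in> F" and YF: "Y \<omega> \<in> F" if "\<omega> \<in> space M" for \<omega>
    using X Y that by (auto simp: Lp_vec_def space_norm_borel dest: measurable_space)
  have const: "(\<lambda>_. z) \<in> Lp_vec p M F nrm" if "z \<in> F" for z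
    using that by (auto simp: Lp_vec_def space_norm_borel)
  have intX: "integrable M (\<lambda>\<omega>. nrm (X \<omega> - z) powr p)"
    and intY: "integrable M (\<lambda>\<omega>. nrm (Y \<omega> - z) powr p)"
    and intY': "integrable M (\<lambda>\<omega>. nrm (z - Y \<omega>) powr p)" if "z \<in> F" for z
    using Lp_vec_integrable_diff p X Y const[OF that] by auto
  define f where "f = (\<lambda>(x, y). nrm (x - y) powr p)"
  have f: "f \<in> borel_measurable (norm_borel F nrm \<Otimes>\<^sub>M norm_borel F nrm)"
    using borel_measurable_nrm_diff unfolding f_def case_prod_beta by measurable
  have fint: "integrable M (\<lambda>\<omega>. f (X \<omega>, Y \<omega>))"
    unfolding f_def using Lp_vec_integrable_diff[OF p X Y] by simp
  define g where "g b = expectation (\<lambda>\<omega>. nrm (X \<omega> - b) powr p)" for b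
  define h where "h a = expectation (\<lambda>\<omega>. nrm (a - Y \<omega>) powr p)" for a
  define D where "D = expectation (\<lambda>\<omega>. nrm (X \<omega> - Y \<omega>) powr p)"
  define c :: real where "c = (3 / 2) powr p"
  note Fub = indep_var_Fubini[OF indep f fint, unfolded f_def prod.case, folded g_def h_def D_def]
  have centre: "?I \<le> c * (2 / 3) * (g b + h a + nrm (a - b) powr p)" if ab: "a \<in> F" "b \<in> F" for a b
  proof -
    define z where "z = scale (1/2) (a + b)"
    have z: "z \<in> F"
      using nrm_diff_midpoint_le(1) ab z_def by blast
    let ?R = "\<lambda>\<omega>. c * (2 / 3 * nrm (X \<omega> - b) powr p + 1 / 3 * nrm (a - b) powr p)
                + c * (2 / 3 * nrm (a - Y \<omega>) powr p + 1 / 3 * nrm (a - b) powr p)"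
    have "?I \<le> expectation (\<lambda>\<omega>. nrm (X \<omega> - z) powr p + nrm (Y \<omega> - z) powr p)"
      by (rule cINF_lower[OF _ z], rule bdd_belowI2[of _ 0]) simp
    also have "\<dots> \<le> expectation ?R"
    proof (rule integral_mono)
      fix \<omega> assume "\<omega> \<in> space M"
      note F = XF[OF this] YF[OF this] ab z
      have "nrm (X \<omega> - z) powr p \<le> (nrm (X \<omega> - b) + nrm (a - b) / 2) powr p"
        using nrm_diff_midpoint_le[of "X \<omega>" a b] F p
        by (intro powr_mono2) (auto simp: z_def nrm_nonneg diff_mem_F)
      also have "\<dots> \<le> c * (2 / 3 * nrm (X \<omega> - b) powr p + 1 / 3 * nrm (a - b) powr p)"
        unfolding c_def using F p by (intro powr_add_half_le) (auto simp: nrm_nonneg diff_mem_F)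
      finally have 1: "nrm (X \<omega> - z) powr p \<le> \<dots>" .
      have "nrm (Y \<omega> - z) powr p \<le> (nrm (a - Y \<omega>) + nrm (a - b) / 2) powr p"
        using nrm_diff_midpoint_le[of "Y \<omega>" b a] F p
        by (intro powr_mono2)
          (auto simp: z_def nrm_nonneg diff_mem_F nrm_minus_commute[of b a] nrm_minus_commute[of "Y \<omega>" a] add.commute)
      also have "\<dots> \<le> c * (2 / 3 * nrm (a - Y \<omega>) powr p + 1 / 3 * nrm (a - b) powr p)"
        unfolding c_def using F p by (intro powr_add_half_le) (auto simp: nrm_nonneg diff_mem_F)
      finally show "nrm (X \<omega> - z) powr p + nrm (Y \<omega> - z) powr p \<le> ?R \<omega>"
        using 1 by simp
    qed (use intX intY intY' ab z in auto)
    also have "\<dots> = c * (2 / 3) * (g b + h a + nrm (a - b) powr p)"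
      using intX[OF ab(2)] intY'[OF ab(1)] by (simp add: g_def h_def prob_space algebra_simps)
    finally show ?thesis .
  qed
  \<comment> \<open>The values \<open>a = X \<omega>\<close> and \<open>b = Y \<omega>\<close> may be taken at the same \<open>\<omega>\<close>: \<open>g (Y \<omega>)\<close> and \<open>h (X \<omega>)\<close>
    already average over fresh copies of the other variable.\<close>
  have "?I = expectation (\<lambda>_. ?I)"
    by (simp add: prob_space)
  also have "\<dots> \<le> expectation (\<lambda>\<omega>. c * (2 / 3) * (g (Y \<omega>) + h (X \<omega>) + nrm (X \<omega> - Y \<omega>) powr p))"
    using Fub(1,3) Lp_vec_integrable_diff[OF p X Y] XF YF
    by (intro integral_mono centre) auto
  also have "\<dots> = c * (2 / 3) * (D + D + D)"
    using Fub Lp_vec_integrable_diff[OF p X Y] by (simp add: D_def)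
  also have "\<dots> = 3 powr p / 2 powr (p - 1) * D"
    by (simp add: c_def powr_divide powr_diff)
  finally show ?thesis
    by (simp add: D_def)
qed

end

section \<open>A finite-dimensional sup-norm space\<close>

text \<open>
  Finite sequences are padded with zeros, so that the spaces of all dimensions are subspaces of the
  one type \<open>nat \<Rightarrow> complex\<close>. The condition that the coordinates sum to zero is what makes these
  spaces bad: whatever a centre gains in some coordinates it loses in others.
\<close>

definition balanced :: "nat \<Rightarrow> (nat \<Rightarrow> complex) set" where
  "balanced N = {w. (\<forall>k\<ge>N. w k = 0) \<and> (\<Sum>k<N. w k) = 0}"

definition max_norm :: "nat \<Rightarrow> (nat \<Rightarrow> complex) \<Rightarrow> real" where
  "max_norm N w = Max ((\<lambda>k. cmod (w k)) ` {..<N})"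

lemma max_norm_le_iff: "N > 0 \<Longrightarrow> max_norm N w \<le> r \<longleftrightarrow> (\<forall>k<N. cmod (w k) \<le> r)"
  by (subst max_norm_def, subst Max_le_iff) auto

lemma max_norm_less_iff: "N > 0 \<Longrightarrow> max_norm N w < r \<longleftrightarrow> (\<forall>k<N. cmod (w k) < r)"
  by (subst max_norm_def, subst Max_less_iff) auto

lemma cmod_le_max_norm: "k < N \<Longrightarrow> cmod (w k) \<le> max_norm N w"
  unfolding max_norm_def by (rule Max_ge) auto

lemma complex_normed_space_balanced:
  assumes N: "N > 0"
  shows "complex_normed_space (\<lambda>c w k. c * w k) (balanced N) (max_norm N)"
proof -
  interpret vector_space "\<lambda>(c::complex) (w::nat \<Rightarrow> complex) k. c * w k"
    by unfold_locales (auto simp: fun_eq_iff algebra_simps)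
  show ?thesis
  proof
    show "subspace (balanced N)"
      by (auto simp: subspace_def balanced_def sum.distrib simp flip: sum_distrib_left)
  next
    fix x :: "nat \<Rightarrow> complex" assume x: "x \<in> balanced N"
    show nn: "0 \<le> max_norm N x"
      using cmod_le_max_norm[OF N, of x] norm_ge_zero order_trans by blast
    have "max_norm N x \<le> 0 \<longleftrightarrow> x = 0"
      using x max_norm_le_iff[OF N, of x 0] by (auto simp: balanced_def fun_eq_iff not_less[symmetric])
    with nn show "max_norm N x = 0 \<longleftrightarrow> x = 0" by linarith
  next
    fix x y :: "nat \<Rightarrow> complex"
    show "max_norm N (x + y) \<le> max_norm N x + max_norm N y"
      unfolding max_norm_le_iff[OF N]
      by (auto intro!: norm_triangle_le add_mono cmod_le_max_norm)
  next
    fix c and x :: "nat \<Rightarrow> complex"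
    have ne: "(\<lambda>k. cmod (x k)) ` {..<N} \<noteq> {}" using N by auto
    have "mono ((*) (cmod c))" by (auto intro!: monoI mult_left_mono)
    from mono_Max_commute[OF this _ ne]
    show "max_norm N (\<lambda>k. c * x k) = cmod c * max_norm N x"
      by (simp add: max_norm_def norm_mult image_image)
  qed
qed

lemma separable_complex_banach_space_balanced:
  assumes N: "N > 0"
  shows "separable_complex_banach_space (\<lambda>c w k. c * w k) (balanced N) (max_norm N)"
proof -
  interpret complex_normed_space "\<lambda>c w k. c * w k" "balanced N" "max_norm N"
    by (rule complex_normed_space_balanced[OF N])
  show ?thesis
  proof
    show "mcomplete"
      unfolding mcomplete_def
    proof (intro allI impI)
      fix s assume s: "MCauchy s"
      then have sF: "s i \<in> balanced N" for i
        by (auto simp: MCauchy_def)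
      have close: "\<exists>K. \<forall>i\<ge>K. \<forall>j\<ge>K. \<forall>k<N. cmod (s i k - s j k) < e" if "e > 0" for e
      proof -
        obtain K where "\<And>i j. K \<le> i \<Longrightarrow> K \<le> j \<Longrightarrow> norm_dist (balanced N) (max_norm N) (s i) (s j) < e"
          using s \<open>e > 0\<close> unfolding MCauchy_def by blast
        then have "\<And>i j. K \<le> i \<Longrightarrow> K \<le> j \<Longrightarrow> max_norm N (s i - s j) < e"
          by (simp add: norm_dist_def sF)
        then show ?thesis
          unfolding max_norm_less_iff[OF N] by auto
      qed
      have "convergent (\<lambda>i. s i k)" for k
      proof (cases "k < N")
        case True
        then have "Cauchy (\<lambda>i. s i k)"
          using close unfolding Cauchy_def dist_norm by meson
        then show ?thesis by (simp add: Cauchy_convergent)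
      next
        case False
        then have "(\<lambda>i. s i k) = (\<lambda>_. 0)" using sF by (auto simp: balanced_def)
        then show ?thesis by (simp add: convergent_const)
      qed
      then obtain l where l: "\<And>k. (\<lambda>i. s i k) \<longlonglongrightarrow> l k"
        unfolding convergent_def by metis
      have lF: "l \<in> balanced N"
      proof -
        have "l k = 0" if "k \<ge> N" for k
          using l[of k] sF that by (auto simp: balanced_def LIMSEQ_const_iff)
        moreover have "(\<lambda>i. \<Sum>k<N. s i k) \<longlonglongrightarrow> (\<Sum>k<N. l k)"
          by (intro tendsto_sum l)
        then have "(\<Sum>k<N. l k) = 0"
          using sF by (auto simp: balanced_def LIMSEQ_const_iff)
        ultimately show ?thesis by (simp add: balanced_def)
      qed
      have "limitin mtopology s l sequentially"
        unfolding limitin_metric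
      proof (intro conjI allI impI lF)
        fix e :: real assume "e > 0"
        have "\<forall>\<^sub>F i in sequentially. \<forall>k\<in>{..<N}. dist (s i k) (l k) < e"
          using l \<open>e > 0\<close> by (intro eventually_ball_finite) (auto dest: tendstoD)
        then show "\<forall>\<^sub>F i in sequentially. s i \<in> balanced N \<and> norm_dist (balanced N) (max_norm N) (s i) l < e"
          by eventually_elim (use sF lF in \<open>auto simp: norm_dist_def max_norm_less_iff[OF N] dist_norm\<close>)
      qed
      then show "\<exists>x. limitin mtopology s x sequentially" by (rule exI[of _ l])
    qed
  next
    \<comment> \<open>Any subset of the countable product of copies of the complex plane is separable for the
      product topology, and a ball of the sup norm over \<open>N\<close> coordinates is the trace on \<open>balanced N\<close>
      of a product-open set.\<close>
    obtain T where T: "countable T" "T \<subseteq> balanced N" "balanced N \<subseteq> closure T"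
      using separable by blast
    have "mtopology closure_of T = balanced N"
      unfolding metric_closure_of
    proof (intro equalityI subsetI CollectI conjI allI impI)
      fix w e assume w: "w \<in> balanced N" and "e > (0::real)"
      let ?U = "\<Inter>k<N. {g. dist (g k) (w k) < e}"
      have "open ?U"
        by (intro open_INT ballI open_Collect_less continuous_intros) auto
      moreover have "w \<in> ?U" using \<open>e > 0\<close> by simp
      moreover have "w \<in> closure T" using T w by blast
      ultimately have "?U \<inter> T \<noteq> {}"
        using open_Int_closure_eq_empty[of ?U T] by blast
      then obtain g where g: "g \<in> T" "g \<in> ?U" by blast
      then have "max_norm N (w - g) < e"
        by (simp add: max_norm_less_iff[OF N] dist_norm norm_minus_commute)
      then show "\<exists>y\<in>T. y \<in> mball w e"
        using g w T by (auto intro!: bexI[of _ g] simp: norm_dist_def)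
    qed auto
    with T show "separable_space (norm_topology (balanced N) (max_norm N))"
      unfolding separable_space_def norm_topology_def by auto
  qed
qed

section \<open>The extremal configuration\<close>

text \<open>
  The indices below \<open>n\<close> and those from \<open>n\<close> to \<open>2 * n - 1\<close> form two blocks. Vectors with peaks \<open>m\<close> in
  different blocks differ by at most 1 in every coordinate, because the values are \<open>3 / 2\<close> or
  \<open>- 1 / 2\<close> in the block of \<open>m\<close> and \<open>1 / 2\<close> in the other one. These values sum to 2, and the
  correction \<open>1 / n\<close> in all \<open>2 * n\<close> coordinates brings the vector into \<open>balanced (2 * n)\<close>.
\<close>

definition spike :: "nat \<Rightarrow> nat \<Rightarrow> nat \<Rightarrow> complex" where
  "spike n m k = (if k < 2 * n then of_real
     ((if k = m then 3 / 2 else if (k < n \<longleftrightarrow> m < n) then - 1 / 2 else 1 / 2) - 1 / n) else 0)"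

lemma spike_balanced:
  assumes "m < 2 * n"
  shows "spike n m \<in> balanced (2 * n)"
proof -
  \<comment> \<open>\<open>S\<close> is the block of \<open>m\<close> and \<open>T\<close> is the other block.\<close>
  define S where "S = (if m < n then {..<n} else {n..<2 * n})"
  define T where "T = (if m < n then {n..<2 * n} else {..<n})"
  have ST: "{..<2 * n} = S \<union> T" "S \<inter> T = {}" "finite S" "finite T" "m \<in> S"
    and card: "card S = n" "card T = n"
    using assms by (auto simp: S_def T_def)
  have n: "n > 0" using assms by simp
  have "(\<Sum>k<2 * n. spike n m k) = (\<Sum>k\<in>S. spike n m k) + (\<Sum>k\<in>T. spike n m k)"
    unfolding ST(1) using ST by (intro sum.union_disjoint) auto
  also have "(\<Sum>k\<in>S. spike n m k) = (\<Sum>k\<in>S. (if k = m then 2 else 0) + (- 1 / 2 - 1 / of_nat n))"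
    using assms by (intro sum.cong) (auto simp: S_def spike_def split: if_splits)
  also have "\<dots> = 2 + of_nat n * (- 1 / 2 - 1 / of_nat n)"
    using ST card by (simp add: sum.distrib)
  also have "(\<Sum>k\<in>T. spike n m k) = (\<Sum>k\<in>T. 1 / 2 - 1 / of_nat n)"
    using assms by (intro sum.cong) (auto simp: T_def spike_def split: if_splits)
  also have "\<dots> = of_nat n * (1 / 2 - 1 / of_nat n)"
    using card by simp
  also have "2 + of_nat n * (- 1 / 2 - 1 / of_nat n) + of_nat n * (1 / 2 - 1 / of_nat n) = (0::complex)"
    using n by (simp add: field_simps)
  finally show ?thesis
    by (simp add: balanced_def spike_def)
qed

lemma max_norm_spike_diff:
  assumes "i < n" "j < n"
  shows "max_norm (2 * n) (spike n i - spike n (n + j)) = 1"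
proof (rule antisym)
  show "max_norm (2 * n) (spike n i - spike n (n + j)) \<le> 1"
    using assms by (subst max_norm_le_iff) (auto simp: spike_def simp flip: of_real_diff)
  have "cmod ((spike n i - spike n (n + j)) i) = 1"
    using assms by (simp add: spike_def flip: of_real_diff)
  then show "1 \<le> max_norm (2 * n) (spike n i - spike n (n + j))"
    using cmod_le_max_norm[of i "2 * n" "spike n i - spike n (n + j)"] assms by simp
qed

text \<open>
  A pair of independent discrete variables transported along an encoding \<open>e\<close> into another sample
  space, as long as each variable can be read off from the code. The hypotheses on \<open>X\<close> and \<open>Y\<close> at all
  points, also those that are not codes, make both of them measurable.
\<close>

lemma indep_var_map_pair_pmf:
  fixes P :: "'i::countable pmf" and Q :: "'j::countable pmf"
  assumes X: "\<And>\<omega>. X \<omega> \<in> space S" and Y: "\<And>\<omega>. Y \<omega> \<in> space T"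
    and Xe: "\<And>i j. X (e (i, j)) = f i" and Ye: "\<And>i j. Y (e (i, j)) = g j"
  shows "prob_space.indep_var (measure_pmf (map_pmf e (pair_pmf P Q))) S X T Y"
proof -
  let ?M = "map_pmf e (pair_pmf P Q)"
  have joint: "emeasure ?M (X -` A \<inter> Y -` B)
      = ennreal (measure_pmf.prob P (f -` A) * measure_pmf.prob Q (g -` B))" for A B
  proof -
    have "e -` (X -` A \<inter> Y -` B) = f -` A \<times> g -` B"
      by (auto simp: Xe Ye)
    then show ?thesis
      by (simp add: measure_pmf_prob_product measure_pmf.emeasure_eq_measure)
  qed
  have X': "X \<in> ?M \<rightarrow>\<^sub>M S" and Y': "Y \<in> ?M \<rightarrow>\<^sub>M T"
    using X Y by auto
  interpret PX: prob_space "distr ?M S X" by (rule measure_pmf.prob_space_distr[OF X'])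
  interpret PY: prob_space "distr ?M T Y" by (rule measure_pmf.prob_space_distr[OF Y'])
  have "distr ?M S X \<Otimes>\<^sub>M distr ?M T Y = distr ?M (S \<Otimes>\<^sub>M T) (\<lambda>\<omega>. (X \<omega>, Y \<omega>))"
  proof (rule pair_measure_eqI)
    fix A B assume A: "A \<in> sets (distr ?M S X)" and B: "B \<in> sets (distr ?M T Y)"
    have "(\<lambda>\<omega>. (X \<omega>, Y \<omega>)) -` (A \<times> B) = X -` A \<inter> Y -` B" by auto
    then have "emeasure (distr ?M (S \<Otimes>\<^sub>M T) (\<lambda>\<omega>. (X \<omega>, Y \<omega>))) (A \<times> B) = emeasure ?M (X -` A \<inter> Y -` B)"
      using A B X Y by (subst emeasure_distr) (auto simp: space_pair_measure)
    moreover have "emeasure (distr ?M S X) A = emeasure ?M (X -` A \<inter> Y -` UNIV)"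
      using A X' by (subst emeasure_distr) auto
    moreover have "emeasure (distr ?M T Y) B = emeasure ?M (X -` UNIV \<inter> Y -` B)"
      using B Y' by (subst emeasure_distr) auto
    ultimately show "emeasure (distr ?M S X) A * emeasure (distr ?M T Y) B
        = emeasure (distr ?M (S \<Otimes>\<^sub>M T) (\<lambda>\<omega>. (X \<omega>, Y \<omega>))) (A \<times> B)"
      unfolding joint by (simp add: ennreal_mult)
  qed (unfold_locales, simp)
  with X' Y' show ?thesis
    unfolding prob_space.indep_var_distribution_eq[OF measure_pmf.prob_space_axioms] by simp
qed

text \<open>
  Test the norm of \<open>spike n m - z\<close> on the coordinate \<open>m\<close>, where the spike has its peak
  \<open>c = 3 / 2 - 1 / n\<close>. The coordinates of \<open>z\<close> cancel in the sum over all \<open>m\<close>, so the tested values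
  average to \<open>c\<close>, and Jensen's inequality gives the bound for the \<open>p\<close>-th powers.
\<close>

lemma sum_powr_max_norm_spike_ge:
  assumes p: "p \<ge> 1" and n: "n > 0" and z: "z \<in> balanced (2 * n)"
  shows "2 * real n * (3 / 2 - 1 / n) powr p \<le> (\<Sum>m<2 * n. max_norm (2 * n) (spike n m - z) powr p)"
proof -
  define c :: real where "c = 3 / 2 - 1 / n"
  have c: "c > 0" using n by (simp add: c_def field_simps)
  have "(\<Sum>m<2 * n. spike n m m - z m) = of_real (2 * real n * c)"
    using z by (simp add: sum_subtractf balanced_def spike_def c_def)
  then have "2 * real n * c \<le> (\<Sum>m<2 * n. cmod (spike n m m - z m))"
    using norm_sum[of "\<lambda>m. spike n m m - z m" "{..<2 * n}"] c by (simp add: norm_mult)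
  then have "0 \<le> p * c powr (p - 1) * ((\<Sum>m<2 * n. cmod (spike n m m - z m)) - 2 * real n * c)"
    using p by simp
  then have "2 * real n * c powr p
      \<le> (\<Sum>m<2 * n. c powr p + p * c powr (p - 1) * (cmod (spike n m m - z m) - c))"
    by (simp add: sum.distrib sum_subtractf flip: sum_distrib_left)
  also have "\<dots> \<le> (\<Sum>m<2 * n. cmod (spike n m m - z m) powr p)"
    using p c by (intro sum_mono powr_ge_tangent) auto
  also have "\<dots> \<le> (\<Sum>m<2 * n. max_norm (2 * n) (spike n m - z) powr p)"
    using p by (intro sum_mono powr_mono2) (use cmod_le_max_norm[of _ "2 * n" "spike n _ - z"] in auto)
  finally show ?thesis by (simp add: c_def)
qed

text \<open>
  \<open>X\<close> is uniform on the \<open>n\<close> spikes of the first block and \<open>Y\<close> is uniform on those of the second. The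
  pair of indices is encoded in one natural number, viewed as a real sample point. Averaging over
  both variables averages over all \<open>2 * n\<close> spikes.
\<close>

lemma exists_spike_vectors:
  fixes p :: real
  assumes p: "p \<ge> 1" and n: "n > 0"
  defines "F \<equiv> balanced (2 * n)" and "nrm \<equiv> max_norm (2 * n)"
  shows "\<exists>(M :: real measure) X Y. prob_space M \<and>
           X \<in> Lp_vec p M F nrm \<and> Y \<in> Lp_vec p M F nrm \<and>
           prob_space.indep_var M (norm_borel F nrm) X (norm_borel F nrm) Y \<and>
           prob_space.expectation M (\<lambda>\<omega>. nrm (X \<omega> - Y \<omega>) powr p) = 1 \<and>
           (\<forall>z\<in>F. 2 * (3 / 2 - 1 / n) powr p
              \<le> prob_space.expectation M (\<lambda>\<omega>. nrm (X \<omega> - z) powr p + nrm (Y \<omega> - z) powr p))"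
proof -
  interpret complex_normed_space "\<lambda>c w k. c * w k" F nrm
    unfolding F_def nrm_def using n by (intro complex_normed_space_balanced) simp
  define U where "U = pmf_of_set {..<n}"
  define e where "e = (\<lambda>ij. real (prod_encode ij))"
  define M where "M = map_pmf e (pair_pmf U U)"
  \<comment> \<open>Reduction modulo \<open>n\<close> keeps the values in the space at sample points that are not codes.\<close>
  define X where "X \<omega> = spike n (fst (prod_decode (nat \<lfloor>\<omega>\<rfloor>)) mod n)" for \<omega> :: real
  define Y where "Y \<omega> = spike n (n + snd (prod_decode (nat \<lfloor>\<omega>\<rfloor>)) mod n)" for \<omega> :: real
  have Xe: "X (e (i, j)) = spike n (i mod n)" and Ye: "Y (e (i, j)) = spike n (n + j mod n)" for i j
    by (simp_all add: X_def Y_def e_def)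
  have XF: "X \<omega> \<in> F" and YF: "Y \<omega> \<in> F" for \<omega>
  proof -
    have "k mod n < 2 * n" "n + k mod n < 2 * n" for k
      using mod_less_divisor[OF n, of k] by linarith+
    then show "X \<omega> \<in> F" "Y \<omega> \<in> F"
      unfolding X_def Y_def F_def by (blast intro: spike_balanced)+
  qed
  have U: "set_pmf U = {..<n}"
    unfolding U_def using n by (subst set_pmf_of_set) auto
  have fin: "finite (set_pmf M)"
    by (simp add: M_def U)
  have int: "integrable M h" for h :: "real \<Rightarrow> real"
    by (rule integrable_measure_pmf_finite[OF fin])
  have EU: "measure_pmf.expectation U h = (\<Sum>i<n. h i) / n" for h :: "nat \<Rightarrow> real"
    unfolding U_def using n by (subst integral_pmf_of_set) auto
  have EX: "measure_pmf.expectation M (\<lambda>\<omega>. h (X \<omega>)) = (\<Sum>i<n. h (spike n i)) / n"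
    and EY: "measure_pmf.expectation M (\<lambda>\<omega>. h (Y \<omega>)) = (\<Sum>j<n. h (spike n (n + j))) / n"
    for h :: "(nat \<Rightarrow> complex) \<Rightarrow> real"
  proof -
    have "measure_pmf.expectation M (\<lambda>\<omega>. h (X \<omega>))
        = measure_pmf.expectation (pair_pmf U U) (\<lambda>ij. h (spike n (fst ij mod n)))"
      unfolding M_def integral_map_pmf by (intro Bochner_Integration.integral_cong) (auto simp: Xe)
    also have "\<dots> = measure_pmf.expectation U (\<lambda>i. h (spike n (i mod n)))"
      by (rule expectation_pair_pmf_fst)
    finally show "measure_pmf.expectation M (\<lambda>\<omega>. h (X \<omega>)) = (\<Sum>i<n. h (spike n i)) / n"
      by (simp add: EU)
    have "measure_pmf.expectation M (\<lambda>\<omega>. h (Y \<omega>))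
        = measure_pmf.expectation (pair_pmf U U) (\<lambda>ij. h (spike n (n + snd ij mod n)))"
      unfolding M_def integral_map_pmf by (intro Bochner_Integration.integral_cong) (auto simp: Ye)
    also have "\<dots> = measure_pmf.expectation U (\<lambda>j. h (spike n (n + j mod n)))"
      by (rule expectation_pair_pmf_snd)
    finally show "measure_pmf.expectation M (\<lambda>\<omega>. h (Y \<omega>)) = (\<Sum>j<n. h (spike n (n + j))) / n"
      by (simp add: EU)
  qed
  have split: "(\<Sum>m<n + k. h m) = (\<Sum>i<n. h i) + (\<Sum>j<k. h (n + j))" for h :: "nat \<Rightarrow> real" and k
    by (induction k) auto
  show ?thesis
  proof (rule exI[of _ "measure_pmf M"], rule exI[of _ X], rule exI[of _ Y], intro conjI ballI)
    show "prob_space M" by (rule measure_pmf.prob_space_axioms)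
    show "X \<in> Lp_vec p M F nrm" "Y \<in> Lp_vec p M F nrm"
      using XF YF int by (auto simp: Lp_vec_def space_norm_borel)
    show "prob_space.indep_var M (norm_borel F nrm) X (norm_borel F nrm) Y"
      unfolding M_def
      by (rule indep_var_map_pair_pmf[where f = "\<lambda>i. spike n (i mod n)" and g = "\<lambda>j. spike n (n + j mod n)"])
        (use XF YF Xe Ye in \<open>auto simp: space_norm_borel\<close>)
    have "nrm (X \<omega> - Y \<omega>) = 1" for \<omega>
      unfolding X_def Y_def nrm_def using n by (intro max_norm_spike_diff) auto
    then show "measure_pmf.expectation M (\<lambda>\<omega>. nrm (X \<omega> - Y \<omega>) powr p) = 1"
      by simp
  next
    fix z assume "z \<in> F"
    then have "2 * real n * (3 / 2 - 1 / n) powr p \<le> (\<Sum>m<2 * n. nrm (spike n m - z) powr p)"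
      unfolding F_def nrm_def by (rule sum_powr_max_norm_spike_ge[OF p n])
    then have "2 * (3 / 2 - 1 / n) powr p \<le> (\<Sum>m<2 * n. nrm (spike n m - z) powr p) / n"
      using n by (simp add: pos_le_divide_eq mult_ac)
    also have "\<dots> = (\<Sum>m<n + n. nrm (spike n m - z) powr p) / n"
      by (simp only: mult_2)
    also have "\<dots> = measure_pmf.expectation M (\<lambda>\<omega>. nrm (X \<omega> - z) powr p)
                  + measure_pmf.expectation M (\<lambda>\<omega>. nrm (Y \<omega> - z) powr p)"
      unfolding split EX[of "\<lambda>x. nrm (x - z) powr p"] EY[of "\<lambda>x. nrm (x - z) powr p"]
      by (simp add: add_divide_distrib)
    also have "\<dots> = measure_pmf.expectation M (\<lambda>\<omega>. nrm (X \<omega> - z) powr p + nrm (Y \<omega> - z) powr p)"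
      using int by simp
    finally show "2 * (3 / 2 - 1 / n) powr p
        \<le> measure_pmf.expectation M (\<lambda>\<omega>. nrm (X \<omega> - z) powr p + nrm (Y \<omega> - z) powr p)" .
  qed
qed

lemma exists_spike_dimension:
  fixes p C :: real
  assumes p: "p \<ge> 1" and C: "C < 3 powr p / 2 powr (p - 1)"
  shows "\<exists>n. (0::nat) < n \<and> C < 2 * (3 / 2 - 1 / real n) powr p"
proof -
  have "(\<lambda>n. 2 * (3 / 2 - 1 / real n) powr p) \<longlonglongrightarrow> 2 * (3 / 2 - 0) powr p"
    by (intro tendsto_intros lim_1_over_n) auto
  moreover have "2 * (3 / 2 - 0) powr p = 3 powr p / 2 powr (p - 1)"
    by (simp add: powr_divide powr_diff)
  ultimately have "\<forall>\<^sub>F n in sequentially. C < 2 * (3 / 2 - 1 / real n) powr p"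
    using C order_tendstoD(1) by metis
  then have "\<forall>\<^sub>F n in sequentially. (0::nat) < n \<and> C < 2 * (3 / 2 - 1 / real n) powr p"
    using eventually_gt_at_top[of "0::nat"] by eventually_elim simp
  then show ?thesis
    by (rule eventually_happens'[OF sequentially_bot])
qed

section \<open>The inequality and its optimality\<close>

theorem theorem1p1:
  fixes p :: real
  assumes "p \<ge> 1"
  shows "(\<forall>(scale :: complex \<Rightarrow> 'v::ab_group_add \<Rightarrow> 'v) (F :: 'v set) (nrm :: 'v \<Rightarrow> real)
            (M :: 'a measure) (X :: 'a \<Rightarrow> 'v) (Y :: 'a \<Rightarrow> 'v).
            separable_complex_banach_space scale F nrm \<and> prob_space M \<and>
            X \<in> Lp_vec p M F nrm \<and> Y \<in> Lp_vec p M F nrm \<and>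
            prob_space.indep_var M (norm_borel F nrm) X (norm_borel F nrm) Y \<longrightarrow>
              (INF z\<in>F. prob_space.expectation M (\<lambda>\<omega>. nrm (X \<omega> - z) powr p + nrm (Y \<omega> - z) powr p))
                \<le> 3 powr p / 2 powr (p - 1) * prob_space.expectation M (\<lambda>\<omega>. nrm (X \<omega> - Y \<omega>) powr p))
       \<and> (\<forall>C < 3 powr p / 2 powr (p - 1).
           \<exists>(scale :: complex \<Rightarrow> (nat \<Rightarrow> complex) \<Rightarrow> nat \<Rightarrow> complex) (F :: (nat \<Rightarrow> complex) set)
            (nrm :: (nat \<Rightarrow> complex) \<Rightarrow> real) (M :: real measure)
            (X :: real \<Rightarrow> nat \<Rightarrow> complex) (Y :: real \<Rightarrow> nat \<Rightarrow> complex).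
            separable_complex_banach_space scale F nrm \<and> prob_space M \<and>
            X \<in> Lp_vec p M F nrm \<and> Y \<in> Lp_vec p M F nrm \<and>
            prob_space.indep_var M (norm_borel F nrm) X (norm_borel F nrm) Y \<and>
            \<not> (INF z\<in>F. prob_space.expectation M (\<lambda>\<omega>. nrm (X \<omega> - z) powr p + nrm (Y \<omega> - z) powr p))
                \<le> C * prob_space.expectation M (\<lambda>\<omega>. nrm (X \<omega> - Y \<omega>) powr p))"
proof (intro conjI allI impI)
  fix scale :: "complex \<Rightarrow> 'v \<Rightarrow> 'v" and F :: "'v set" and nrm :: "'v \<Rightarrow> real"
    and M :: "'a measure" and X Y :: "'a \<Rightarrow> 'v"
  assume "separable_complex_banach_space scale F nrm \<and> prob_space M \<and>
            X \<in> Lp_vec p M F nrm \<and> Y \<in> Lp_vec p M F nrm \<and>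
            prob_space.indep_var M (norm_borel F nrm) X (norm_borel F nrm) Y"
  then show "(INF z\<in>F. prob_space.expectation M (\<lambda>\<omega>. nrm (X \<omega> - z) powr p + nrm (Y \<omega> - z) powr p))
                \<le> 3 powr p / 2 powr (p - 1) * prob_space.expectation M (\<lambda>\<omega>. nrm (X \<omega> - Y \<omega>) powr p)"
    using separable_complex_banach_space.INF_expectation_le[of scale F nrm p M X Y] assms by blast
next
  fix C :: real assume "C < 3 powr p / 2 powr (p - 1)"
  then obtain n :: nat where n: "n > 0" and Cn: "C < 2 * (3 / 2 - 1 / n) powr p"
    using exists_spike_dimension[OF assms] by blast
  let ?F = "balanced (2 * n)" and ?nrm = "max_norm (2 * n)"
  obtain M :: "real measure" and X Y where ex: "prob_space M \<and>
      X \<in> Lp_vec p M ?F ?nrm \<and> Y \<in> Lp_vec p M ?F ?nrm \<and>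
      prob_space.indep_var M (norm_borel ?F ?nrm) X (norm_borel ?F ?nrm) Y \<and>
      prob_space.expectation M (\<lambda>\<omega>. ?nrm (X \<omega> - Y \<omega>) powr p) = 1 \<and>
      (\<forall>z\<in>?F. 2 * (3 / 2 - 1 / n) powr p
        \<le> prob_space.expectation M (\<lambda>\<omega>. ?nrm (X \<omega> - z) powr p + ?nrm (Y \<omega> - z) powr p))"
    using exists_spike_vectors[OF assms n] by (elim exE) (rule that)
  then have dist: "prob_space.expectation M (\<lambda>\<omega>. ?nrm (X \<omega> - Y \<omega>) powr p) = 1"
    and far: "\<And>z. z \<in> ?F \<Longrightarrow> 2 * (3 / 2 - 1 / n) powr p
        \<le> prob_space.expectation M (\<lambda>\<omega>. ?nrm (X \<omega> - z) powr p + ?nrm (Y \<omega> - z) powr p)"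
    by blast+
  have "0 \<in> ?F" by (simp add: balanced_def)
  then have "2 * (3 / 2 - 1 / n) powr p
      \<le> (INF z\<in>?F. prob_space.expectation M (\<lambda>\<omega>. ?nrm (X \<omega> - z) powr p + ?nrm (Y \<omega> - z) powr p))"
    using far by (intro cINF_greatest) auto
  with Cn dist have "\<not> (INF z\<in>?F. prob_space.expectation M (\<lambda>\<omega>. ?nrm (X \<omega> - z) powr p + ?nrm (Y \<omega> - z) powr p))
                \<le> C * prob_space.expectation M (\<lambda>\<omega>. ?nrm (X \<omega> - Y \<omega>) powr p)"
    by simp
  moreover have "separable_complex_banach_space (\<lambda>c w k. c * w k) ?F ?nrm"
    using n by (intro separable_complex_banach_space_balanced) simp
  ultimately show "\<exists>(scale :: complex \<Rightarrow> (nat \<Rightarrow> complex) \<Rightarrow> nat \<Rightarrow> complex) (F :: (nat \<Rightarrow> complex) set)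
            (nrm :: (nat \<Rightarrow> complex) \<Rightarrow> real) (M :: real measure)
            (X :: real \<Rightarrow> nat \<Rightarrow> complex) (Y :: real \<Rightarrow> nat \<Rightarrow> complex).
            separable_complex_banach_space scale F nrm \<and> prob_space M \<and>
            X \<in> Lp_vec p M F nrm \<and> Y \<in> Lp_vec p M F nrm \<and>
            prob_space.indep_var M (norm_borel F nrm) X (norm_borel F nrm) Y \<and>
            \<not> (INF z\<in>F. prob_space.expectation M (\<lambda>\<omega>. nrm (X \<omega> - z) powr p + nrm (Y \<omega> - z) powr p))
                \<le> C * prob_space.expectation M (\<lambda>\<omega>. nrm (X \<omega> - Y \<omega>) powr p)"
    using ex by blast
qed

end
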